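(* Let $(w_n(t))_{n\in\mathbb{Z}}$ be a genus $g$ meromorphic solution of the infinite Volterra lattice $\dot w_n=w_n(w_{n+1}-w_{n-1})$, $n\in\mathbb{Z}$. Upon setting, for $j\in\mathbb{Z}$, $$a_{j+1}:=w_{2j-1}w_{2j},\qquad b_{j+1}:=-w_{2j}-w_{2j+1},$$ the sequence of meromorphic functions $a_j(t),b_j(t)$ is a solution of the infinite Toda lattice $$\frac{\mathrm{d}a_n}{\mathrm{d}t}=a_n(b_{n-1}-b_n),\qquad\frac{\mathrm{d}b_n}{\mathrm{d}t}=a_n-a_{n+1},\qquad n\in\mathbb{Z},$$ while another sequence of meromorphic solutions of the same Toda lattice is given, for $j\in\mathbb{Z}$, by $$a^*_{j+1}:=w_{2j}w_{2j+1},\qquad b^*_{j+1}:=-w_{2j+1}-w_{2j+2}.$$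
   Context: A dot denotes $\mathrm{d}/\mathrm{d}t$. "Genus $g$ meromorphic solution" of the Volterra lattice refers to the following solutions. $M_g$ is the affine space of triplets of complex polynomials $\mathcal{P}=1+\sum_{i=1}^gp_ix^i$, $\mathcal{Q}=2+\sum_{i=1}^gq_ix^i$, $\mathcal{R}=\sum_{i=1}^{g+1}r_ix^i$; take a generic (meromorphic in $t$) integral curve of the vector field $\dot{\mathcal{P}}=\frac{\mathcal{R}}{x}-\frac{r_1}2\mathcal{Q}$, $\dot{\mathcal{Q}}=\frac{2p_1-q_1}2\mathcal{Q}-\frac{2\mathcal{P}-\mathcal{Q}}x$, $\dot{\mathcal{R}}=r_1\mathcal{P}+\frac{q_1-2p_1}2\mathcal{R}-\frac{\mathcal{R}}x$ on $M_g$, let $(\mathcal{P}_n,\mathcal{Q}_n,\mathcal{R}_n)$, $n\in\mathbb{Z}$, be its images under the iterates of the birational map $(\mathcal{P},\mathcal{Q},\mathcal{R})\mapsto\big(\mathcal{Q}-\mathcal{P},\frac{2\mathcal{P}-\mathcal{Q}+\mathcal{R}}{-wx},-wx\mathcal{Q}\big)$, $w=-\frac12(2p_1-q_1+r_1)$, and let $w_n(t)=-\frac12r_{n,1}(t)$ with $r_{n,1}$ the coefficient of $x$ in $\mathcal{R}_n$. The sequence $(w_n(t))_{n\in\mathbb{Z}}$ satisfies the Volterra lattice. *)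

theory Defs
  imports "HOL-Complex_Analysis.Complex_Analysis"
begin

type_synonym triplet = "complex poly \<times> complex poly \<times> complex poly"

definition M :: "nat \<Rightarrow> triplet set" where
  "M g = {(P, Q, R).
     degree P \<le> g \<and> coeff P 0 = 1 \<and>
     degree Q \<le> g \<and> coeff Q 0 = 2 \<and>
     degree R \<le> g + 1 \<and> coeff R 0 = 0}"

(* In the next two definitions the numerators of all quotients by multiples of x have zero
   constant term on M g, so "div" is exact division of polynomials there (in volterra_map
   provided that volterra_w is nonzero). *)

definition volterra_field :: "triplet \<Rightarrow> triplet" where
  "volterra_field = (\<lambda>(P, Q, R).
     let p1 = coeff P 1; q1 = coeff Q 1; r1 = coeff R 1 in
     (R div [:0, 1:] - smult (r1 / 2) Q,
      smult ((2 * p1 - q1) / 2) Q - (smult 2 P - Q) div [:0, 1:],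
      smult r1 P + smult ((q1 - 2 * p1) / 2) R - R div [:0, 1:]))"

definition volterra_w :: "triplet \<Rightarrow> complex" where
  "volterra_w = (\<lambda>(P, Q, R). - (2 * coeff P 1 - coeff Q 1 + coeff R 1) / 2)"

definition volterra_map :: "triplet \<Rightarrow> triplet" where
  "volterra_map = (\<lambda>(P, Q, R).
     let w = volterra_w (P, Q, R) in
     (Q - P, (smult 2 P - Q + R) div [:0, - w:], [:0, - w:] * Q))"

definition triplet_coeff :: "nat \<Rightarrow> triplet \<Rightarrow> complex \<times> complex \<times> complex" where
  "triplet_coeff i = (\<lambda>(P, Q, R). (coeff P i, coeff Q i, coeff R i))"

definition meromorphic_curve :: "(complex \<Rightarrow> triplet) \<Rightarrow> bool" where
  "meromorphic_curve \<gamma> \<longleftrightarrow>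
     (\<forall>i. (\<lambda>t. fst (triplet_coeff i (\<gamma> t))) meromorphic_on UNIV \<and>
          (\<lambda>t. fst (snd (triplet_coeff i (\<gamma> t)))) meromorphic_on UNIV \<and>
          (\<lambda>t. snd (snd (triplet_coeff i (\<gamma> t)))) meromorphic_on UNIV)"

definition has_triplet_derivative :: "(complex \<Rightarrow> triplet) \<Rightarrow> triplet \<Rightarrow> complex \<Rightarrow> bool" where
  "has_triplet_derivative \<gamma> V t \<longleftrightarrow>
     (\<forall>i. ((\<lambda>s. fst (triplet_coeff i (\<gamma> s)))
             has_field_derivative fst (triplet_coeff i V)) (at t) \<and>
          ((\<lambda>s. fst (snd (triplet_coeff i (\<gamma> s))))
             has_field_derivative fst (snd (triplet_coeff i V))) (at t) \<and>
          ((\<lambda>s. snd (snd (triplet_coeff i (\<gamma> s))))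
             has_field_derivative snd (snd (triplet_coeff i V))) (at t))"

(* A library meromorphic function has arbitrary values at its poles and at a discrete set of
   further points.  Identities between meromorphic functions are therefore required for all t
   outside a closed discrete subset of the plane; this is what the quantifier over cosparse sets
   says. *)

definition meromorphic_integral_curve :: "nat \<Rightarrow> (complex \<Rightarrow> triplet) \<Rightarrow> bool" where
  "meromorphic_integral_curve g \<gamma> \<longleftrightarrow>
     meromorphic_curve \<gamma> \<and>
     (\<forall>\<^sub>\<approx>t\<in>UNIV. \<gamma> t \<in> M g \<and> has_triplet_derivative \<gamma> (volterra_field (\<gamma> t)) t)"

(* T n is the image of the integral curve T 0 under the n-th iterate of the birational map.
   The map is injective on the points of M g where volterra_w does not vanish, so that the
   recursion also determines T n for negative n.  Genericity of the curve is what makes all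
   iterates defined along it: volterra_w does not vanish identically on any T n. *)

definition genus_g_volterra_solution :: "nat \<Rightarrow> (int \<Rightarrow> complex \<Rightarrow> complex) \<Rightarrow> bool" where
  "genus_g_volterra_solution g w \<longleftrightarrow>
     (\<exists>T :: int \<Rightarrow> complex \<Rightarrow> triplet.
        meromorphic_integral_curve g (T 0) \<and>
        (\<forall>n. \<forall>\<^sub>\<approx>t\<in>UNIV. T n t \<in> M g \<and> volterra_w (T n t) \<noteq> 0 \<and>
                       T (n + 1) t = volterra_map (T n t)) \<and>
        (\<forall>n t. w n t = - coeff (snd (snd (T n t))) 1 / 2))"

definition meromorphic_toda_solution ::
    "(int \<Rightarrow> complex \<Rightarrow> complex) \<Rightarrow> (int \<Rightarrow> complex \<Rightarrow> complex) \<Rightarrow> bool" where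
  "meromorphic_toda_solution a b \<longleftrightarrow>
     (\<forall>n. a n meromorphic_on UNIV \<and> b n meromorphic_on UNIV \<and>
        (\<forall>\<^sub>\<approx>t\<in>UNIV.
           (a n has_field_derivative a n t * (b (n - 1) t - b n t)) (at t) \<and>
           (b n has_field_derivative a n t - a (n + 1) t) (at t)))"

end

theory Submission
  imports Defs
begin

text \<open>
  Read off on coefficients, the vector field is an infinite quadratic system
  and the birational map is an algebraic relation that can be solved rationally in either
  direction. Differentiating these rational expressions shows that the map and its inverse carry
  solutions to solutions, so every iterate is an integral curve. Eliminating the previous triplet
  then turns the equation of \<open>r\<^sub>1\<close> into the Volterra lattice, from which both Toda
  solutions follow by the product rule; the second one is the first one for the shifted
  Volterra solution.
\<close>

section \<open>Coefficient form of the vector field and of the birational map\<close>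

text \<open>Division by \<open>x\<close> becomes the shift from \<open>i\<close> to
  \<open>Suc i\<close>. The families are infinite, so neither the genus nor a degree bound
  enters.\<close>

definition volterra_flow ::
    "(nat \<Rightarrow> complex \<Rightarrow> complex) \<Rightarrow> (nat \<Rightarrow> complex \<Rightarrow> complex) \<Rightarrow>
     (nat \<Rightarrow> complex \<Rightarrow> complex) \<Rightarrow> complex \<Rightarrow> bool" where
  "volterra_flow p q r t \<longleftrightarrow> (\<forall>i.
     (p i has_field_derivative r (Suc i) t - r 1 t / 2 * q i t) (at t) \<and>
     (q i has_field_derivative
        (2 * p 1 t - q 1 t) / 2 * q i t - (2 * p (Suc i) t - q (Suc i) t)) (at t) \<and>
     (r i has_field_derivative
        r 1 t * p i t + (q 1 t - 2 * p 1 t) / 2 * r i t - r (Suc i) t) (at t))"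

text \<open>The parameter of the map is eliminated through \<open>- 2 w = r\<^sub>1'\<close>.\<close>

definition volterra_link ::
    "(nat \<Rightarrow> complex) \<Rightarrow> (nat \<Rightarrow> complex) \<Rightarrow> (nat \<Rightarrow> complex) \<Rightarrow>
     (nat \<Rightarrow> complex) \<Rightarrow> (nat \<Rightarrow> complex) \<Rightarrow> (nat \<Rightarrow> complex) \<Rightarrow> bool" where
  "volterra_link p q r p' q' r' \<longleftrightarrow>
     p 0 = 1 \<and> q 0 = 2 \<and> r 0 = 0 \<and> r' 0 = 0 \<and> r' 1 \<noteq> 0 \<and> 2 * p 1 - q 1 + r 1 = r' 1 \<and>
     (\<forall>i. p' i = q i - p i \<and>
          r' 1 * q' i = 2 * (2 * p (Suc i) - q (Suc i) + r (Suc i)) \<and>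
          r' (Suc i) = r' 1 / 2 * q i)"

lemma volterra_linkD:
  assumes "volterra_link p q r p' q' r'"
  shows "p 0 = 1" "q 0 = 2" "r 0 = 0" "r' 0 = 0" "r' 1 \<noteq> 0" "r' 1 = 2 * p 1 - q 1 + r 1"
    "p' i = q i - p i"
    "q' i = 2 * (2 * p (Suc i) - q (Suc i) + r (Suc i)) / r' 1"
    "r' (Suc i) = r' 1 / 2 * q i"
  using assms unfolding volterra_link_def by (auto simp: field_simps)

text \<open>The inverse birational map: \<open>R' = -w x Q\<close> yields \<open>q\<close>, then
  \<open>P' = Q - P\<close> yields \<open>p\<close>, and the formula for \<open>Q'\<close> yields
  \<open>r\<close>. Substituting leaves primed data alone on the right, so that meromorphy can later
  be read off directly.\<close>

lemma volterra_link_inverseD: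
  assumes "volterra_link p q r p' q' r'"
  shows "q i = 2 * r' (Suc i) / r' 1"
    "p i = 2 * r' (Suc i) / r' 1 - p' i"
    "r (Suc i) = r' 1 / 2 * q' i - 2 * r' (Suc (Suc i)) / r' 1 + 2 * p' (Suc i)"
proof -
  note L = volterra_linkD[OF assms]
  have q: "q j = 2 * r' (Suc j) / r' 1" for j
    using L(5) L(9)[of j] by (simp add: field_simps)
  have p: "p j = q j - p' j" for j
    using L(7)[of j] by simp
  have r: "r (Suc i) = r' 1 / 2 * q' i - 2 * p (Suc i) + q (Suc i)"
    using L(5) L(8)[of i] by (simp add: field_simps)
  show "q i = 2 * r' (Suc i) / r' 1" by (rule q)
  show "p i = 2 * r' (Suc i) / r' 1 - p' i" using p[of i] unfolding q[of i] .
  show "r (Suc i) = r' 1 / 2 * q' i - 2 * r' (Suc (Suc i)) / r' 1 + 2 * p' (Suc i)"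
    using r unfolding p[of "Suc i"] unfolding q[of "Suc i"] by simp
qed

section \<open>Transport of the flow along the map, at a single time\<close>

text \<open>The pattern of the computations below: differentiate an explicit formula, replace it by
  the function it equals near \<open>t\<close>, and leave the comparison of the two derivatives as
  an algebraic goal.\<close>

lemma has_field_derivative_transform_ev:
  assumes "(f has_field_derivative D) (at t)" "\<forall>\<^sub>F s in nhds t. f' s = f s" "D' = D"
  shows "(f' has_field_derivative D') (at t)"
  using assms DERIV_cong_ev[of t t f' f D D'] by auto

text \<open>The relation is assumed on a neighbourhood because its solved form is differentiated;
  the resulting identities are then checked at \<open>t\<close> only.\<close>

lemma volterra_flow_forward:
  fixes p q r p' q' r' :: "nat \<Rightarrow> complex \<Rightarrow> complex"
  assumes flow: "volterra_flow p q r t"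
    and link: "\<forall>\<^sub>F s in nhds t. volterra_link (\<lambda>i. p i s) (\<lambda>i. q i s) (\<lambda>i. r i s)
                 (\<lambda>i. p' i s) (\<lambda>i. q' i s) (\<lambda>i. r' i s)"
  shows "volterra_flow p' q' r' t"
proof -
  note L = volterra_linkD[OF eventually_nhds_x_imp_x[OF link]]
  note ev = eventually_mono[OF link]
  have dp: "(p i has_field_derivative r (Suc i) t - r 1 t / 2 * q i t) (at t)"
    and dq: "(q i has_field_derivative
        (2 * p 1 t - q 1 t) / 2 * q i t - (2 * p (Suc i) t - q (Suc i) t)) (at t)"
    and dr: "(r i has_field_derivative
        r 1 t * p i t + (q 1 t - 2 * p 1 t) / 2 * r i t - r (Suc i) t) (at t)" for i
    using flow unfolding volterra_flow_def by auto
  have r1: "r' 1 t \<noteq> 0" using L(5) .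
  \<comment> \<open>Eliminating \<open>p\<close> by the link turns the remaining goals into rational
    identities in the other quantities. \<open>e1\<close> is the case \<open>i = 0\<close>, where
    \<open>q' 0 t = 2\<close>.\<close>
  have e: "p (Suc i) t = (r' 1 t * q' i t / 2 + q (Suc i) t - r (Suc i) t) / 2" for i
    using L(8)[of i] r1 by (simp add: field_simps)
  have e1: "p 1 t = (r' 1 t + q 1 t - r 1 t) / 2"
    using L(6) by simp
  \<comment> \<open>This derivative comes first, since \<open>r' 1\<close> is a factor of every
    \<open>r' (Suc j)\<close> and the denominator of every \<open>q' i\<close>.\<close>
  have d1: "(r' 1 has_field_derivative r' 1 t * (q' 1 t - q 1 t) / 2) (at t)"
    apply (rule has_field_derivative_transform_ev)
      apply (rule DERIV_add[OF DERIV_diff[OF DERIV_cmult[OF dp[of 1], of 2] dq[of 1]] dr[of 1]])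
     apply (rule ev, erule volterra_linkD(6))
    unfolding e[of 1] e1 by (simp add: field_simps)
  have dp': "(p' i has_field_derivative r' (Suc i) t - r' 1 t / 2 * q' i t) (at t)" for i
    apply (rule has_field_derivative_transform_ev)
      apply (rule DERIV_diff[OF dq[of i] dp[of i]])
     apply (rule ev, erule volterra_linkD(7))
    unfolding L(9)[of i] e[of i] e1 by (simp add: field_simps)
  have dr': "(r' i has_field_derivative
        r' 1 t * p' i t + (q' 1 t - 2 * p' 1 t) / 2 * r' i t - r' (Suc i) t) (at t)" for i
  proof (cases i)
    case 0
    \<comment> \<open>The prescribed derivative is zero: \<open>r' 0 t = 0\<close> and
      \<open>p' 0 t = q 0 t - p 0 t = 1\<close>, so the two terms in \<open>r' 1 t\<close>
      cancel.\<close>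
    show ?thesis unfolding 0
      apply (rule has_field_derivative_transform_ev)
        apply (rule DERIV_const[of 0])
       apply (rule ev, erule volterra_linkD(4))
      using L(4) L(7)[of 0] L(1,2) by simp
  next
    case (Suc j)
    show ?thesis unfolding Suc
      apply (rule has_field_derivative_transform_ev)
        apply (rule DERIV_mult[OF DERIV_cdivide[OF d1, of 2] dq[of j]])
       apply (rule ev, erule volterra_linkD(9))
      unfolding L(9)[of j] L(9)[of "Suc j"] L(7)[of "Suc j"] L(7)[of 1] by (simp add: field_simps)
  qed
  have dq': "(q' i has_field_derivative
        (2 * p' 1 t - q' 1 t) / 2 * q' i t - (2 * p' (Suc i) t - q' (Suc i) t)) (at t)" for i
  proof -
    let ?D = "(2 * p' 1 t - q' 1 t) / 2 * q' i t - (2 * p' (Suc i) t - q' (Suc i) t)"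
    let ?N = "\<lambda>s. 2 * (2 * p (Suc i) s - q (Suc i) s + r (Suc i) s)"
    have N: "?N t = r' 1 t * q' i t"
      unfolding e[of i] by (simp add: field_simps)
    \<comment> \<open>The derivative of the numerator \<open>r' 1 * q' i\<close> is arranged as the
      product rule would give it if \<open>?D\<close> were the derivative of \<open>q' i\<close>;
      the quotient rule then returns \<open>?D\<close>.\<close>
    have dN: "(?N has_field_derivative r' 1 t * ?D + q' i t * (r' 1 t * (q' 1 t - q 1 t) / 2)) (at t)"
      apply (rule has_field_derivative_transform_ev)
        apply (rule DERIV_cmult[OF DERIV_add[OF DERIV_diff[OF DERIV_cmult[OF dp[of "Suc i"], of 2]
                 dq[of "Suc i"]] dr[of "Suc i"]], of 2])
       apply (rule always_eventually, simp)
      unfolding L(7)[of "Suc i"] L(7)[of 1] e[of i] e[of "Suc i"] e1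
      by (simp add: algebra_simps add_divide_distrib diff_divide_distrib)
    show ?thesis
      apply (rule has_field_derivative_transform_ev)
        apply (rule DERIV_divide[OF dN d1 r1])
       apply (rule ev, erule volterra_linkD(8))
      unfolding N using r1 by (simp add: field_simps)
  qed
  show ?thesis
    unfolding volterra_flow_def using dp' dq' dr' by blast
qed

text \<open>Here the inverse formulas are differentiated, in the order \<open>q\<close>,
  \<open>p\<close>, \<open>r\<close>, each using the derivatives found before it.\<close>

lemma volterra_flow_backward:
  fixes p q r p' q' r' :: "nat \<Rightarrow> complex \<Rightarrow> complex"
  assumes flow: "volterra_flow p' q' r' t"
    and link: "\<forall>\<^sub>F s in nhds t. volterra_link (\<lambda>i. p i s) (\<lambda>i. q i s) (\<lambda>i. r i s)
                 (\<lambda>i. p' i s) (\<lambda>i. q' i s) (\<lambda>i. r' i s)"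
  shows "volterra_flow p q r t"
proof -
  note L = volterra_linkD[OF eventually_nhds_x_imp_x[OF link]]
  note ev = eventually_mono[OF link]
  \<comment> \<open>The facts \<open>dp\<close>, \<open>dq\<close>, \<open>dr\<close> describe the
    given primed functions; \<open>dp'\<close>, \<open>dq'\<close>, \<open>dr'\<close> below are the
    claims about the unprimed ones.\<close>
  have dp: "(p' i has_field_derivative r' (Suc i) t - r' 1 t / 2 * q' i t) (at t)"
    and dq: "(q' i has_field_derivative
        (2 * p' 1 t - q' 1 t) / 2 * q' i t - (2 * p' (Suc i) t - q' (Suc i) t)) (at t)"
    and dr: "(r' i has_field_derivative
        r' 1 t * p' i t + (q' 1 t - 2 * p' 1 t) / 2 * r' i t - r' (Suc i) t) (at t)" for i
    using flow unfolding volterra_flow_def by auto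
  have r1: "r' 1 t \<noteq> 0" using L(5) .
  have e: "p (Suc i) t = (r' 1 t * q' i t / 2 + q (Suc i) t - r (Suc i) t) / 2" for i
    using L(8)[of i] r1 by (simp add: field_simps)
  have e1: "p 1 t = (r' 1 t + q 1 t - r 1 t) / 2"
    using L(6) by simp
  let ?B = "r' 1 t * p' 1 t + (q' 1 t - 2 * p' 1 t) / 2 * r' 1 t - r' (Suc 1) t"
  have dq': "(q i has_field_derivative
        (2 * p 1 t - q 1 t) / 2 * q i t - (2 * p (Suc i) t - q (Suc i) t)) (at t)" for i
  proof -
    let ?D = "(2 * p 1 t - q 1 t) / 2 * q i t - (2 * p (Suc i) t - q (Suc i) t)"
    have N: "2 * r' (Suc i) t = r' 1 t * q i t"
      unfolding L(9)[of i] by simp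
    \<comment> \<open>Again a product-rule form, now of \<open>r' 1 * q i\<close>, with
      \<open>?B\<close> the derivative of \<open>r' 1\<close> given by the flow.\<close>
    have dN: "((\<lambda>s. 2 * r' (Suc i) s) has_field_derivative r' 1 t * ?D + q i t * ?B) (at t)"
      apply (rule has_field_derivative_transform_ev)
        apply (rule DERIV_cmult[OF dr[of "Suc i"], of 2])
       apply (rule always_eventually, simp)
      unfolding L(9)[of i] L(9)[of "Suc i"] L(9)[of 1] L(7)[of "Suc i"] L(7)[of 1] e[of i] e1
      by (simp add: field_simps)
    show ?thesis
      apply (rule has_field_derivative_transform_ev)
        apply (rule DERIV_divide[OF dN dr[of 1] r1])
       apply (rule ev, erule volterra_link_inverseD(1))
      unfolding N using r1 by (simp add: field_simps)
  qed
  have dp': "(p i has_field_derivative r (Suc i) t - r 1 t / 2 * q i t) (at t)" for i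
    apply (rule has_field_derivative_transform_ev)
      apply (rule DERIV_diff[OF dq'[of i] dp[of i]])
     apply (rule ev, drule volterra_linkD(7)[where i = i], simp)
    unfolding L(9)[of i] e[of i] e1 by (simp add: field_simps)
  have dr': "(r i has_field_derivative
        r 1 t * p i t + (q 1 t - 2 * p 1 t) / 2 * r i t - r (Suc i) t) (at t)" for i
  proof (cases i)
    case 0
    show ?thesis unfolding 0
      apply (rule has_field_derivative_transform_ev)
        apply (rule DERIV_const[of 0])
       apply (rule ev, erule volterra_linkD(3))
      using L(1,3) by simp
  next
    \<comment> \<open>\<open>r (Suc j)\<close> is expressed through \<open>p (Suc j)\<close> and
      \<open>q (Suc j)\<close>, whose derivatives are already known, rather than through primed data
      alone.\<close>
    case (Suc j)
    have "\<forall>\<^sub>F s in nhds t. r (Suc j) s = r' 1 s / 2 * q' j s - 2 * p (Suc j) s + q (Suc j) s"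
    proof (rule ev)
      fix s
      assume "volterra_link (\<lambda>i. p i s) (\<lambda>i. q i s) (\<lambda>i. r i s)
                (\<lambda>i. p' i s) (\<lambda>i. q' i s) (\<lambda>i. r' i s)"
      from volterra_linkD(5)[OF this] volterra_linkD(8)[OF this, of j]
      show "r (Suc j) s = r' 1 s / 2 * q' j s - 2 * p (Suc j) s + q (Suc j) s"
        by (simp add: field_simps)
    qed
    then show ?thesis unfolding Suc
      apply (rule has_field_derivative_transform_ev[rotated])
       prefer 2
       apply (rule DERIV_add[OF DERIV_diff[OF DERIV_mult[OF DERIV_cdivide[OF dr[of 1], of 2] dq[of j]]
                 DERIV_cmult[OF dp'[of "Suc j"], of 2]] dq'[of "Suc j"]])
      unfolding L(9)[of j] L(9)[of "Suc j"] L(9)[of 1] L(7)[of "Suc j"] L(7)[of 1] L(7)[of j]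
        e[of j] e[of "Suc j"] e1
      by (simp add: field_simps)
  qed
  show ?thesis
    unfolding volterra_flow_def using dp' dq' dr' by blast
qed

section \<open>From single times to meromorphic families\<close>

text \<open>Identities valid off a closed discrete set become identities near almost every point,
  which is what differentiating them requires.\<close>

lemma eventually_cosparse_nhds:
  fixes P :: "'a::t1_space \<Rightarrow> bool"
  assumes "\<forall>\<^sub>\<approx>t\<in>UNIV. P t"
  shows "\<forall>\<^sub>\<approx>t\<in>UNIV. \<forall>\<^sub>F s in nhds t. P s"
proof -
  have "\<forall>\<^sub>F t in at z. \<forall>\<^sub>F s in nhds t. P s" for z
  proof -
    have "\<forall>\<^sub>F t in at z. P t"
      using assms by (simp add: eventually_cosparse_open_eq)
    then obtain S where S: "open S" "z \<in> S" "\<forall>x\<in>S. x \<noteq> z \<longrightarrow> P x"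
      unfolding eventually_at_topological by blast
    \<comment> \<open>In a T1 space \<open>S - {z}\<close> is open, hence a neighbourhood of each of
      its points.\<close>
    have "\<forall>\<^sub>F s in nhds t. P s" if "t \<in> S" "t \<noteq> z" for t
      using S that eventually_nhds_in_open[of "S - {z}" t]
      by (auto simp: open_delete elim: eventually_mono)
    then show ?thesis
      using S(1,2) unfolding eventually_at_topological by blast
  qed
  then show ?thesis by (simp add: eventually_cosparse_open_eq)
qed

lemma meromorphic_on_cong_cosparse:
  assumes "g meromorphic_on UNIV" "\<forall>\<^sub>\<approx>t\<in>UNIV. f t = g t"
  shows "f meromorphic_on UNIV"
  using assms meromorphic_on_cong[of UNIV f g UNIV] by (simp add: eventually_cosparse_open_eq)

definition meromorphic_volterra_flow ::
    "(nat \<Rightarrow> complex \<Rightarrow> complex) \<Rightarrow> (nat \<Rightarrow> complex \<Rightarrow> complex) \<Rightarrow>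
     (nat \<Rightarrow> complex \<Rightarrow> complex) \<Rightarrow> bool" where
  "meromorphic_volterra_flow p q r \<longleftrightarrow>
     (\<forall>i. p i meromorphic_on UNIV \<and> q i meromorphic_on UNIV \<and> r i meromorphic_on UNIV) \<and>
     (\<forall>\<^sub>\<approx>t\<in>UNIV. volterra_flow p q r t)"

lemma meromorphic_volterra_flow_forward:
  assumes flow: "meromorphic_volterra_flow p q r"
    and link: "\<forall>\<^sub>\<approx>s\<in>UNIV. volterra_link (\<lambda>i. p i s) (\<lambda>i. q i s) (\<lambda>i. r i s)
                 (\<lambda>i. p' i s) (\<lambda>i. q' i s) (\<lambda>i. r' i s)"
  shows "meromorphic_volterra_flow p' q' r'"
proof -
  have mero: "p i meromorphic_on UNIV" "q i meromorphic_on UNIV" "r i meromorphic_on UNIV" for i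
    using flow unfolding meromorphic_volterra_flow_def by auto
  note cong = meromorphic_on_cong_cosparse[OF _ eventually_mono[OF link]]
  \<comment> \<open>Needed first: the formulas for \<open>q'\<close> and \<open>r'\<close> contain
    \<open>r' 1\<close>.\<close>
  have r1: "r' 1 meromorphic_on UNIV"
    by (rule cong[rotated], erule volterra_linkD(6)) (intro meromorphic_intros mero)
  have "p' i meromorphic_on UNIV" for i
    by (rule cong[rotated], erule volterra_linkD(7)) (intro meromorphic_intros mero)
  moreover have "q' i meromorphic_on UNIV" for i
    by (rule cong[rotated], erule volterra_linkD(8)) (intro meromorphic_intros mero r1)
  moreover have "r' i meromorphic_on UNIV" for i
  proof (cases i)
    case 0
    show ?thesis unfolding 0
      by (rule cong[rotated], erule volterra_linkD(4)) (intro meromorphic_intros)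
  next
    case (Suc j)
    show ?thesis unfolding Suc
      by (rule cong[rotated], erule volterra_linkD(9)) (intro meromorphic_intros mero r1)
  qed
  moreover have "\<forall>\<^sub>\<approx>t\<in>UNIV. volterra_flow p' q' r' t"
    using flow eventually_cosparse_nhds[OF link] unfolding meromorphic_volterra_flow_def
    by (auto elim: eventually_elim2 intro: volterra_flow_forward)
  ultimately show ?thesis unfolding meromorphic_volterra_flow_def by blast
qed

lemma meromorphic_volterra_flow_backward:
  assumes flow: "meromorphic_volterra_flow p' q' r'"
    and link: "\<forall>\<^sub>\<approx>s\<in>UNIV. volterra_link (\<lambda>i. p i s) (\<lambda>i. q i s) (\<lambda>i. r i s)
                 (\<lambda>i. p' i s) (\<lambda>i. q' i s) (\<lambda>i. r' i s)"
  shows "meromorphic_volterra_flow p q r"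
proof -
  have mero: "p' i meromorphic_on UNIV" "q' i meromorphic_on UNIV" "r' i meromorphic_on UNIV" for i
    using flow unfolding meromorphic_volterra_flow_def by auto
  note cong = meromorphic_on_cong_cosparse[OF _ eventually_mono[OF link]]
  have "q i meromorphic_on UNIV" for i
    by (rule cong[rotated], erule volterra_link_inverseD(1)) (intro meromorphic_intros mero)
  moreover have "p i meromorphic_on UNIV" for i
    by (rule cong[rotated], erule volterra_link_inverseD(2)) (intro meromorphic_intros mero)
  moreover have "r i meromorphic_on UNIV" for i
  proof (cases i)
    case 0
    show ?thesis unfolding 0
      by (rule cong[rotated], erule volterra_linkD(3)) (intro meromorphic_intros)
  next
    case (Suc j)
    show ?thesis unfolding Suc
      by (rule cong[rotated], erule volterra_link_inverseD(3)) (intro meromorphic_intros mero)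
  qed
  moreover have "\<forall>\<^sub>\<approx>t\<in>UNIV. volterra_flow p q r t"
    using flow eventually_cosparse_nhds[OF link] unfolding meromorphic_volterra_flow_def
    by (auto elim: eventually_elim2 intro: volterra_flow_backward)
  ultimately show ?thesis unfolding meromorphic_volterra_flow_def by blast
qed

section \<open>From polynomial triplets to coefficient families\<close>

text \<open>The constant term of \<open>P\<close> is the remainder and is discarded. For
  \<open>c = 0\<close> both sides are zero by the conventions for division.\<close>

lemma coeff_div_linear_monomial:
  fixes P :: "complex poly"
  shows "coeff (P div [:0, c:]) i = coeff P (Suc i) / c"
proof (cases "c = 0")
  case False
  obtain a P' where P: "P = pCons a P'" by (cases P)
  have "P = [:0, c:] * smult (1 / c) P' + [:a:]"
    using False by (simp add: P)
  then have "P div [:0, c:] = ([:0, c:] * smult (1 / c) P' + [:a:]) div [:0, c:]"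
    by simp
  also have "\<dots> = smult (1 / c) P'"
    using False by (subst div_mult_self4) (auto simp: div_poly_less)
  finally show ?thesis by (simp add: P)
qed simp

text \<open>As \<open>Q\<close> has constant term 2, the coefficient of \<open>x\<close> in
  \<open>-w x Q\<close> is \<open>-2 w\<close>; thus \<open>w\<close> being nonzero is the condition
  \<open>r' 1 \<noteq> 0\<close>.\<close>

lemma volterra_link_volterra_map:
  assumes "(P, Q, R) \<in> M g" "volterra_w (P, Q, R) \<noteq> 0"
    and "volterra_map (P, Q, R) = (P', Q', R')"
  shows "volterra_link (coeff P) (coeff Q) (coeff R) (coeff P') (coeff Q') (coeff R')"
proof -
  define w where "w = volterra_w (P, Q, R)"
  have w: "2 * coeff P 1 - coeff Q 1 + coeff R 1 = - 2 * w"
    by (simp add: w_def volterra_w_def)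
  have *: "P' = Q - P" "Q' = (smult 2 P - Q + R) div [:0, - w:]" "R' = [:0, - w:] * Q"
    using assms(3) by (auto simp: volterra_map_def w_def Let_def)
  have "w \<noteq> 0" using assms(2) by (simp add: w_def)
  moreover have "coeff P 0 = 1" "coeff Q 0 = 2" "coeff R 0 = 0"
    using assms(1) by (auto simp: M_def)
  ultimately show ?thesis
    using w unfolding volterra_link_def * by (simp add: coeff_div_linear_monomial field_simps)
qed

lemma volterra_flow_integral_curve:
  assumes "has_triplet_derivative \<gamma> (volterra_field (\<gamma> t)) t"
  shows "volterra_flow (\<lambda>i s. coeff (fst (\<gamma> s)) i) (\<lambda>i s. coeff (fst (snd (\<gamma> s))) i)
           (\<lambda>i s. coeff (snd (snd (\<gamma> s))) i) t"
  using assms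
  by (auto simp: has_triplet_derivative_def volterra_flow_def volterra_field_def Let_def
      triplet_coeff_def case_prod_unfold coeff_div_linear_monomial)

section \<open>The Volterra lattice\<close>

definition meromorphic_volterra_solution :: "(int \<Rightarrow> complex \<Rightarrow> complex) \<Rightarrow> bool" where
  "meromorphic_volterra_solution w \<longleftrightarrow>
     (\<forall>n. w n meromorphic_on UNIV \<and>
        (\<forall>\<^sub>\<approx>t\<in>UNIV. (w n has_field_derivative w n t * (w (n + 1) t - w (n - 1) t)) (at t)))"

lemma genus_g_volterra_solution_imp_meromorphic_volterra_solution:
  assumes "genus_g_volterra_solution g w"
  shows "meromorphic_volterra_solution w"
proof -
  from assms obtain T :: "int \<Rightarrow> complex \<Rightarrow> triplet" where
    T0: "meromorphic_integral_curve g (T 0)"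
    and T: "\<And>n. \<forall>\<^sub>\<approx>t\<in>UNIV. T n t \<in> M g \<and> volterra_w (T n t) \<noteq> 0 \<and>
                       T (n + 1) t = volterra_map (T n t)"
    and w: "\<And>n t. w n t = - coeff (snd (snd (T n t))) 1 / 2"
    unfolding genus_g_volterra_solution_def by blast
  define p where "p n i t = coeff (fst (T n t)) i" for n i t
  define q where "q n i t = coeff (fst (snd (T n t))) i" for n i t
  define r where "r n i t = coeff (snd (snd (T n t))) i" for n i t
  have link: "\<forall>\<^sub>\<approx>t\<in>UNIV. volterra_link (\<lambda>i. p n i t) (\<lambda>i. q n i t) (\<lambda>i. r n i t)
     (\<lambda>i. p (n + 1) i t) (\<lambda>i. q (n + 1) i t) (\<lambda>i. r (n + 1) i t)" for n
    using T[of n]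
  proof (rule eventually_mono)
    fix t
    assume "T n t \<in> M g \<and> volterra_w (T n t) \<noteq> 0 \<and> T (n + 1) t = volterra_map (T n t)"
    then show "volterra_link (\<lambda>i. p n i t) (\<lambda>i. q n i t) (\<lambda>i. r n i t)
     (\<lambda>i. p (n + 1) i t) (\<lambda>i. q (n + 1) i t) (\<lambda>i. r (n + 1) i t)"
      unfolding p_def q_def r_def by (intro volterra_link_volterra_map[of _ _ _ g]) auto
  qed
  \<comment> \<open>Only the curve with index 0 is given as an integral curve; induction in both
    directions from 0 reaches all integers.\<close>
  have flow: "meromorphic_volterra_flow (p n) (q n) (r n)" for n
  proof (induction n rule: int_induct[where k = 0])
    case base
    have "\<forall>\<^sub>\<approx>t\<in>UNIV. volterra_flow (p 0) (q 0) (r 0) t"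
      using T0 volterra_flow_integral_curve
      unfolding meromorphic_integral_curve_def p_def q_def r_def
      by (auto elim: eventually_mono)
    then show ?case
      using T0 unfolding meromorphic_integral_curve_def meromorphic_curve_def
        meromorphic_volterra_flow_def p_def q_def r_def triplet_coeff_def case_prod_unfold by simp
  next
    case (step1 i)
    then show ?case using meromorphic_volterra_flow_forward link by blast
  next
    case (step2 i)
    then show ?case using meromorphic_volterra_flow_backward link[of "i - 1"] by simp
  qed
  show ?thesis
    unfolding meromorphic_volterra_solution_def
  proof (intro allI conjI)
    fix n
    have wr: "w m = (\<lambda>t. - r m 1 t / 2)" for m
      by (auto simp: w r_def)
    show "w n meromorphic_on UNIV"
      unfolding wr using flow[of n] unfolding meromorphic_volterra_flow_def
      by (intro meromorphic_intros) auto
    have "\<forall>\<^sub>\<approx>t\<in>UNIV. volterra_flow (p n) (q n) (r n) t"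
      using flow[of n] unfolding meromorphic_volterra_flow_def by blast
    with link[of n] link[of "n - 1"]
    show "\<forall>\<^sub>\<approx>t\<in>UNIV. (w n has_field_derivative w n t * (w (n + 1) t - w (n - 1) t)) (at t)"
    proof eventually_elim
      case (elim t)
      have d: "(r n 1 has_field_derivative
        r n 1 t * p n 1 t + (q n 1 t - 2 * p n 1 t) / 2 * r n 1 t - r n (Suc 1) t) (at t)"
        using elim(3) unfolding volterra_flow_def by blast
      note L = volterra_linkD[OF elim(1)]
        and K = volterra_linkD[OF elim(2)[unfolded diff_add_cancel]]
      have prev: "r (n - 1) 1 t = r n 1 t - 2 * p (n - 1) 1 t + q (n - 1) 1 t"
        using K(6) by simp
      \<comment> \<open>Both sides equal \<open>r n 1 t * (q n 1 t - q (n - 1) 1 t) / 2\<close>. The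
        link \<open>K\<close> from \<open>n - 1\<close> to \<open>n\<close> supplies
        \<open>r n (Suc 1)\<close>, \<open>p n 1\<close> and, via \<open>prev\<close>,
        \<open>r (n - 1) 1\<close>; the link \<open>L\<close> from \<open>n\<close> to
        \<open>n + 1\<close> supplies \<open>r (n + 1) 1\<close>. The last factor on the right is
        \<open>w (n + 1) t - w (n - 1) t\<close>.\<close>
      have *: "r n 1 t * p n 1 t + (q n 1 t - 2 * p n 1 t) / 2 * r n 1 t - r n (Suc 1) t =
         r n 1 t * (- r (n + 1) 1 t / 2 + r (n - 1) 1 t / 2)"
        unfolding L(6) prev K(9)[of 1] K(7)[of 1]
        by (simp add: algebra_simps add_divide_distrib diff_divide_distrib)
      show ?case
        unfolding wr using DERIV_cdivide[OF DERIV_minus[OF d], of 2] unfolding *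
        by (simp add: field_simps)
    qed
  qed
qed

section \<open>The two Toda solutions\<close>

lemma meromorphic_volterra_solution_shift:
  assumes "meromorphic_volterra_solution w"
  shows "meromorphic_volterra_solution (\<lambda>n. w (n + k))"
  unfolding meromorphic_volterra_solution_def
proof
  fix n
  show "w (n + k) meromorphic_on UNIV \<and> (\<forall>\<^sub>\<approx>t\<in>UNIV. (w (n + k) has_field_derivative
          w (n + k) t * (w (n + 1 + k) t - w (n - 1 + k) t)) (at t))"
    using assms[unfolded meromorphic_volterra_solution_def, rule_format, of "n + k"]
    by (simp add: algebra_simps)
qed

text \<open>The logarithmic derivatives of the two factors of \<open>a n\<close> add up to
  \<open>b (n - 1) - b n\<close>. In the derivative of \<open>b n\<close> the products
  \<open>w (2 * j) * w (2 * j + 1)\<close> cancel, leaving \<open>a n - a (n + 1)\<close>.\<close>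

lemma meromorphic_toda_solution_of_volterra:
  fixes w a b :: "int \<Rightarrow> complex \<Rightarrow> complex"
  assumes w: "meromorphic_volterra_solution w"
    and a: "\<And>j t. a (j + 1) t = w (2 * j - 1) t * w (2 * j) t"
    and b: "\<And>j t. b (j + 1) t = - w (2 * j) t - w (2 * j + 1) t"
  shows "meromorphic_toda_solution a b"
  unfolding meromorphic_toda_solution_def
proof (intro allI conjI)
  fix n :: int
  \<comment> \<open>The defining formulas are indexed by \<open>j + 1\<close>, so
    \<open>n = j + 1\<close>.\<close>
  define j where "j = n - 1"
  have mero: "w m meromorphic_on UNIV" for m
    using w unfolding meromorphic_volterra_solution_def by blast
  have dw: "\<forall>\<^sub>\<approx>t\<in>UNIV. (w m has_field_derivative w m t * (w (m + 1) t - w (m - 1) t)) (at t)" for m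
    using w unfolding meromorphic_volterra_solution_def by blast
  have an: "a n = (\<lambda>t. w (2 * j - 1) t * w (2 * j) t)"
    using a[of j] by (auto simp: j_def)
  have bn: "b n = (\<lambda>t. - w (2 * j) t - w (2 * j + 1) t)"
    using b[of j] by (auto simp: j_def)
  have an': "a (n + 1) t = w (2 * j + 1) t * w (2 * j + 2) t" for t
    using a[of n] by (simp add: j_def algebra_simps)
  have bn': "b (n - 1) t = - w (2 * j - 2) t - w (2 * j - 1) t" for t
    using b[of "n - 2"] by (simp add: j_def algebra_simps)
  show "a n meromorphic_on UNIV" "b n meromorphic_on UNIV"
    unfolding an bn by (intro meromorphic_intros mero)+
  show "\<forall>\<^sub>\<approx>t\<in>UNIV. (a n has_field_derivative a n t * (b (n - 1) t - b n t)) (at t) \<and>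
           (b n has_field_derivative a n t - a (n + 1) t) (at t)"
    using dw[of "2 * j - 1"] dw[of "2 * j"] dw[of "2 * j + 1"]
  proof eventually_elim
    case (elim t)
    show ?case
      unfolding an bn an' bn'
      using DERIV_mult[OF elim(1,2)] DERIV_diff[OF DERIV_minus[OF elim(2)] elim(3)]
      by (simp add: algebra_simps)
  qed
qed

theorem corollary5p5:
  fixes g :: nat
    and w a b a' b' :: "int \<Rightarrow> complex \<Rightarrow> complex"
  assumes w: "genus_g_volterra_solution g w"
    and a: "\<And>j t. a (j + 1) t = w (2 * j - 1) t * w (2 * j) t"
    and b: "\<And>j t. b (j + 1) t = - w (2 * j) t - w (2 * j + 1) t"
    and a': "\<And>j t. a' (j + 1) t = w (2 * j) t * w (2 * j + 1) t"
    and b': "\<And>j t. b' (j + 1) t = - w (2 * j + 1) t - w (2 * j + 2) t"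
  shows "meromorphic_toda_solution a b \<and> meromorphic_toda_solution a' b'"
proof
  have volterra: "meromorphic_volterra_solution w"
    using w by (rule genus_g_volterra_solution_imp_meromorphic_volterra_solution)
  then show "meromorphic_toda_solution a b"
    using a b by (rule meromorphic_toda_solution_of_volterra)
  from volterra have "meromorphic_volterra_solution (\<lambda>n. w (n + 1))"
    by (rule meromorphic_volterra_solution_shift)
  \<comment> \<open>Raising every index of \<open>w\<close> by one turns the formulas for
    \<open>a\<close>, \<open>b\<close> into those for \<open>a'\<close>, \<open>b'\<close>.\<close>
  then show "meromorphic_toda_solution a' b'"
    by (rule meromorphic_toda_solution_of_volterra) (simp_all add: a' b' add.commute)
qed

end
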